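(* Let $C>0$, and let $(\mathbf{w}^*;b^*;\mathbf{u}^* )$, with $\boldsymbol{\lambda}^*\in\mathbb{R}^m$ and $\gamma>0$ satisfying $\gamma C\ge 2$, be a P-stationary point of the problem $$\min_{\mathbf{w}\in\mathbb{R}^n,\,b\in\mathbb{R},\,\mathbf{u}\in\mathbb{R}^m}\ \frac12\|\mathbf{w}\|^2+CL_r(\mathbf{u})\quad\text{s.t.}\quad \mathbf{u}+A\mathbf{w}+b\mathbf{y}=\mathbf{1}.$$ Then every $L_r$ support vector lies on one of the support hyperplanes $\langle\mathbf{w}^*,\mathbf{x}\rangle+b^*=\pm1$; that is, every $L_r$ support vector $\mathbf{x}_i$ satisfies $\langle\mathbf{w}^*,\mathbf{x}_i\rangle+b^*=1$ or $\langle\mathbf{w}^*,\mathbf{x}_i\rangle+b^*=-1$.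
   Context: Data: $(\mathbf{x}_i,y_i)$, $i=1,\dots,m$, with $\mathbf{x}_i\in\mathbb{R}^n$, $y_i\in\{-1,1\}$; $A=[y_1\mathbf{x}_1\ y_2\mathbf{x}_2\cdots y_m\mathbf{x}_m]^\top\in\mathbb{R}^{m\times n}$, $\mathbf{y}=(y_1,\dots,y_m)^\top$, $\mathbf{1}=(1,\dots,1)^\top\in\mathbb{R}^m$. The ramp loss is $\ell_r(t)=1$ for $t\ge1$, $\ell_r(t)=t$ for $0\le t<1$, $\ell_r(t)=0$ for $t<0$, and $L_r(\mathbf{u})=\sum_{i=1}^m\ell_r(u_i)$. All norms are Euclidean. For $\gamma>0$ and $\mathbf{s}\in\mathbb{R}^m$, the set-valued proximal operator is $\mathrm{prox}_{\gamma CL_r}(\mathbf{s})=\arg\min_{\mathbf{v}\in\mathbb{R}^m} CL_r(\mathbf{v})+\frac1{2\gamma}\|\mathbf{v}-\mathbf{s}\|^2$ (the set of all global minimizers). $(\mathbf{w}^*;b^*;\mathbf{u}^* )$ with $\boldsymbol{\lambda}^*\in\mathbb{R}^m$ and $\gamma>0$ is a P-stationary (proximal stationary) point of the problem if $$\mathbf{w}^*+A^\top\boldsymbol{\lambda}^*=\mathbf{0},\quad \langle\mathbf{y},\boldsymbol{\lambda}^*\rangle=0,\quad \mathbf{u}^*+A\mathbf{w}^*+b^*\mathbf{y}=\mathbf{1},\quad \mathbf{u}^*\in\mathrm{prox}_{\gamma CL_r}(\mathbf{u}^*-\gamma\boldsymbol{\lambda}^* ).$$ The $L_r$ support vectors (associated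 with this P-stationary point and $\boldsymbol{\lambda}^*$) are the training vectors $\mathbf{x}_i$ with $\lambda_i^*\neq0$, i.e. those that appear with nonzero coefficient in the representation $\mathbf{w}^*=-\sum_{i=1}^m\lambda_i^*y_i\mathbf{x}_i$. *)

theory Defs
  imports "HOL-Analysis.Analysis"
begin

definition ramp_loss :: "real \<Rightarrow> real" where
  "ramp_loss t = (if t \<ge> 1 then 1 else if t \<ge> 0 then t else 0)"

definition L_r :: "real ^ 'm \<Rightarrow> real" where
  "L_r u = (\<Sum>i\<in>UNIV. ramp_loss (u $ i))"

text \<open>The set-valued proximal operator of \<open>\<gamma> f\<close>: all global minimizers, possibly none or several.\<close>

definition prox :: "real \<Rightarrow> (real ^ 'm \<Rightarrow> real) \<Rightarrow> real ^ 'm \<Rightarrow> (real ^ 'm) set" where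
  "prox \<gamma> f s = {v. is_arg_min (\<lambda>v. f v + 1 / (2 * \<gamma>) * (norm (v - s))\<^sup>2) (\<lambda>_. True) v}"

definition data_matrix :: "('m \<Rightarrow> real ^ 'n) \<Rightarrow> real ^ 'm \<Rightarrow> real ^ 'n ^ 'm" where
  "data_matrix x y = (\<chi> i. y $ i *\<^sub>R x i)"

text \<open>P-stationarity, with multiplier \<open>l\<close> and parameter \<open>\<gamma>\<close>, of \<open>(w; b; u)\<close> for the problem of
  minimizing \<open>1/2 (norm w)\<^sup>2 + C * L_r u\<close> subject to \<open>u + A *v w + b *\<^sub>R y = 1\<close>, where
  \<open>A = data_matrix x y\<close>. The library's \<open>1 :: real ^ 'm\<close> is the all-ones vector.\<close>

definition P_stationary ::
  "('m::finite \<Rightarrow> real ^ 'n) \<Rightarrow> real ^ 'm \<Rightarrow> real \<Rightarrow> real \<Rightarrow> real ^ 'm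
    \<Rightarrow> real ^ 'n \<Rightarrow> real \<Rightarrow> real ^ 'm \<Rightarrow> bool" where
  "P_stationary x y C \<gamma> l w b u \<longleftrightarrow>
     w + transpose (data_matrix x y) *v l = 0 \<and>
     y \<bullet> l = 0 \<and>
     u + data_matrix x y *v w + b *\<^sub>R y = 1 \<and>
     u \<in> prox \<gamma> (\<lambda>v. C * L_r v) (u - \<gamma> *\<^sub>R l)"

definition support_vectors :: "('m \<Rightarrow> real ^ 'n) \<Rightarrow> real ^ 'm \<Rightarrow> (real ^ 'n) set" where
  "support_vectors x l = {x i | i. l $ i \<noteq> 0}"

end

(* The proximal objective is separable, so every coordinate a = u_i minimizes
   C * ramp_loss t + (t - s)^2 / (2 * \<gamma>) with s = a - \<gamma> * l_i. Comparing a with the two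
   candidates t = 0 and t = s already shows, for \<gamma> * C \<ge> 2, that a = s or a = 0. Hence l_i \<noteq> 0
   forces u_i = 0, and the constraint reads y_i * (w \<bullet> x_i + b) = 1. *)
theory Submission
  imports Defs
begin

text \<open>The objective is a sum of one-coordinate terms \<open>h j\<close>. Altering a minimizer
  in coordinate \<open>i\<close> alone leaves all other terms fixed, so they cancel from the
  comparison.\<close>

lemma prox_separable_component:
  fixes u s :: "real ^ 'm::finite"
  assumes "u \<in> prox \<gamma> (\<lambda>v. \<Sum>j\<in>UNIV. g (v $ j)) s"
  shows "g (u $ i) + 1 / (2 * \<gamma>) * (u $ i - s $ i)\<^sup>2 \<le> g t + 1 / (2 * \<gamma>) * (t - s $ i)\<^sup>2"
proof -
  define h where "h j r = g r + 1 / (2 * \<gamma>) * (r - s $ j)\<^sup>2" for j r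
  have obj: "(\<Sum>j\<in>UNIV. g (v $ j)) + 1 / (2 * \<gamma>) * (norm (v - s))\<^sup>2 = (\<Sum>j\<in>UNIV. h j (v $ j))"
    for v
  proof -
    have "(norm (v - s))\<^sup>2 = (\<Sum>j\<in>UNIV. (v $ j - s $ j)\<^sup>2)"
      unfolding power2_norm_eq_inner inner_vec_def by (simp add: power2_eq_square)
    then show ?thesis by (simp only: h_def sum.distrib sum_distrib_left)
  qed
  define v where "v = (\<chi> j. if j = i then t else u $ j)"
  have "(\<Sum>j\<in>UNIV. h j (u $ j)) \<le> (\<Sum>j\<in>UNIV. h j (v $ j))"
    using assms unfolding prox_def is_arg_min_linorder obj by blast
  moreover have "(\<Sum>j\<in>UNIV. h j (r $ j)) = h i (r $ i) + (\<Sum>j\<in>UNIV - {i}. h j (r $ j))" for r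
    by (simp add: sum.remove)
  moreover have "(\<Sum>j\<in>UNIV - {i}. h j (v $ j)) = (\<Sum>j\<in>UNIV - {i}. h j (u $ j))"
    by (rule sum.cong) (auto simp: v_def)
  ultimately have "h i (u $ i) \<le> h i (v $ i)" by simp
  then show ?thesis by (simp add: h_def v_def)
qed

text \<open>This is the scalar problem scaled by 2 * \<gamma>, with \<open>h\<close> standing for
  \<gamma> * C. The sign and size of \<open>a\<close> decide which candidate beats it:
  \<open>s\<close> where the loss at \<open>a\<close> is already at least that at \<open>s\<close>,
  \<open>0\<close> where \<open>a\<close> and \<open>s\<close> lie on opposite sides of it, and both
  together for \<open>a\<close> strictly between 0 and 1.\<close>

lemma ramp_loss_minimizer_cases:
  fixes a s h :: real
  assumes "h \<ge> 2"
    and min: "\<And>t. 2 * h * ramp_loss a + (a - s)\<^sup>2 \<le> 2 * h * ramp_loss t + (t - s)\<^sup>2"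
  shows "a = s \<or> a = 0"
proof (rule ccontr)
  assume "\<not> ?thesis"
  then have ne: "a \<noteq> s" "a \<noteq> 0" by auto
  have sq: "(a - s)\<^sup>2 > 0" using ne by simp
  have at_s: "2 * h * ramp_loss a + (a - s)\<^sup>2 \<le> 2 * h * ramp_loss s" using min[of s] by simp
  have at_0: "2 * h * ramp_loss a + (a - s)\<^sup>2 \<le> s\<^sup>2" using min[of 0] by (simp add: ramp_loss_def)
  have "2 * h * ramp_loss s \<le> 2 * h * 1"
    using \<open>h \<ge> 2\<close> by (intro mult_left_mono) (auto simp: ramp_loss_def)
  \<comment> \<open>As the loss never exceeds 1, this bound no longer depends on the position of
    \<open>s\<close>.\<close>
  with at_s have le: "2 * h * ramp_loss a + (a - s)\<^sup>2 \<le> 2 * h" by simp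
  consider "a < 0" | "a \<ge> 1" | "0 < a" "a < 1" using ne by linarith
  then show False
  proof cases
    case 1
    show False
    proof (cases "s < 0")
      case True
      with 1 at_s sq show False by (simp add: ramp_loss_def)
    next
      case False
      \<comment> \<open>With a < 0 \<le> s, the point 0 has the same zero loss as \<open>a\<close>
        but is strictly closer to \<open>s\<close>.\<close>
      have "(a - s)\<^sup>2 = s\<^sup>2 + a\<^sup>2 - 2 * (a * s)" by (simp add: power2_diff)
      moreover have "a * s \<le> 0" using 1 False by (simp add: mult_nonpos_nonneg)
      moreover have "a\<^sup>2 > 0" using ne by simp
      moreover have "2 * h * ramp_loss a = 0" using 1 by (simp add: ramp_loss_def)
      ultimately show False using at_0 by linarith
    qed
  next
    case 2
    with le sq show False by (simp add: ramp_loss_def)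
  next
    case 3
    then have ra: "ramp_loss a = a" by (simp add: ramp_loss_def)
    \<comment> \<open>Cancelling a > 0 turns the comparison with 0 into a lower bound on the
      distance: s - a \<ge> h - a / 2 > 0.\<close>
    have "a * (2 * h + a) \<le> a * (2 * s)"
      using at_0 ra by (simp add: power2_eq_square algebra_simps)
    then have s_ge: "2 * h + a \<le> 2 * s" using 3 by simp
    then have "(h - a / 2)\<^sup>2 \<le> (a - s)\<^sup>2"
      using 3 \<open>h \<ge> 2\<close> by (subst power2_commute[of a s]) (intro power_mono, auto)
    \<comment> \<open>The left side is the square of h + a / 2. It exceeds h * h, and h \<ge> 2
      makes that at least 2 * h.\<close>
    then have "h * h + h * a + a * a / 4 \<le> 2 * h"
      using le ra by (simp add: power2_eq_square algebra_simps)
    moreover have "2 * h \<le> h * h" using \<open>h \<ge> 2\<close> by simp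
    moreover have "h * a > 0" "a * a > 0" using 3 \<open>h \<ge> 2\<close> by simp_all
    ultimately show False by linarith
  qed
qed

theorem theorem4:
  fixes x :: "'m::finite \<Rightarrow> real ^ 'n" and y l u :: "real ^ 'm" and w :: "real ^ 'n"
    and b C \<gamma> :: real
  assumes labels: "\<And>i. y $ i \<in> {-1, 1}"
    and "C > 0" and "\<gamma> > 0" and "\<gamma> * C \<ge> 2"
    and "P_stationary x y C \<gamma> l w b u"
  shows "\<forall>z \<in> support_vectors x l. w \<bullet> z + b = 1 \<or> w \<bullet> z + b = -1"
proof
  fix z assume "z \<in> support_vectors x l"
  then obtain i where z: "z = x i" and li: "l $ i \<noteq> 0" by (auto simp: support_vectors_def)
  have feas: "u + data_matrix x y *v w + b *\<^sub>R y = 1"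
    and pr: "u \<in> prox \<gamma> (\<lambda>v. \<Sum>j\<in>UNIV. C * ramp_loss (v $ j)) (u - \<gamma> *\<^sub>R l)"
    using assms(5) by (auto simp: P_stationary_def L_r_def sum_distrib_left)
  define s where "s = u $ i - \<gamma> * l $ i"
  have "2 * (\<gamma> * C) * ramp_loss (u $ i) + (u $ i - s)\<^sup>2 \<le> 2 * (\<gamma> * C) * ramp_loss t + (t - s)\<^sup>2" for t
  proof -
    have "C * ramp_loss (u $ i) + 1 / (2 * \<gamma>) * (u $ i - s)\<^sup>2
        \<le> C * ramp_loss t + 1 / (2 * \<gamma>) * (t - s)\<^sup>2"
      using prox_separable_component[OF pr, of i t] by (simp add: s_def)
    from mult_left_mono[OF this, of "2 * \<gamma>"] show ?thesis
      using \<open>\<gamma> > 0\<close> by (simp add: distrib_left mult_ac)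
  qed
  then have "u $ i = s \<or> u $ i = 0" by (rule ramp_loss_minimizer_cases[OF \<open>\<gamma> * C \<ge> 2\<close>])
  \<comment> \<open>The alternative \<open>u $ i = s\<close> would give \<gamma> * l_i = 0.\<close>
  then have "u $ i = 0" using li \<open>\<gamma> > 0\<close> by (simp add: s_def)
  moreover have "(data_matrix x y *v w) $ i = y $ i * (w \<bullet> x i)"
    by (simp add: data_matrix_def matrix_vector_mult_def inner_vec_def sum_distrib_left mult_ac)
  moreover have "u $ i + (data_matrix x y *v w) $ i + b * y $ i = 1"
    using arg_cong[OF feas, of "\<lambda>v. v $ i"] by simp
  ultimately have "y $ i * (w \<bullet> x i) + b * y $ i = 1" by simp
  \<comment> \<open>A label is its own inverse, so w \<bullet> z + b equals
    \<open>y $ i\<close>.\<close>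
  then show "w \<bullet> z + b = 1 \<or> w \<bullet> z + b = -1"
    using labels[of i] z by auto
qed

end
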